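(* Let $d\ge1$, $0<c_j<1$ for $j\in D=\{1,\dots,d\}$, let $\mathbf{X}_0$ and $\mathbf{Y}_n=(Y_{n,1},\dots,Y_{n,d})$, $n\ge1$, be independent random vectors in $\mathbb{R}^d$ with $\mathbf{Y}_n\sim G$ for all $n$, and let $X_{n,j}=\max(c_jX_{n-1,j},\,Y_{n,j})$ for $n\ge1$, $j\in D$. Suppose $\{\mathbf{X}_n=(X_{n,1},\dots,X_{n,d})\}$ is stationary with common distribution function $F$ having continuous margins $F_1,\dots,F_d$. Let $j,j'\in D$, let $r\ge1$ be an integer, and let $k>0$. If, with $w_{j't}=F_{j'}^{-1}(1-t)$, $$1-F_{j'}\big(c_{j'}^{-r}w_{j't}\big)\sim t^{\,c_{j'}^{-rk}}\quad\text{as }t\downarrow0,$$ then $\lambda_{jj'}^{(r)}(\mathbf{X})=0$ and $1/2\le\eta_{jj'}^{(r)}(\mathbf{X})\le\max\big(1/2,\,c_{j'}^{rk}\big)$.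
   Context: $a(t)\sim b(t)$ as $t\downarrow0$ means $a(t)/b(t)\to1$. $F_{j'}^{-1}$ is the generalized inverse $F_{j'}^{-1}(u)=\inf\{y:F_{j'}(y)\ge u\}$. The lag-$r$ tail dependence coefficient is $\lambda_{jj'}^{(r)}(\mathbf{X})=\lim_{t\downarrow0}P\big(F_{j'}(X_{1+r,j'})>1-t\,\big|\,F_j(X_{1,j})>1-t\big)$. The lag-$r$ Ledford and Tawn coefficient $\eta_{jj'}^{(r)}(\mathbf{X})\in(0,1]$ is defined as the constant (when it exists; the bounds on it are understood in this case) such that $$P\big(F_{j'}(X_{1+r,j'})>1-t\,\big|\,F_j(X_{1,j})>1-t\big)\sim L(t)\,t^{1/\eta_{jj'}^{(r)}(\mathbf{X})-1}\quad\text{as }t\downarrow0,$$ for some function $L$ slowly varying at $0$, i.e. $L(tx)/L(t)\to1$ as $t\downarrow0$ for every fixed $x>0$. *)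

theory Defs
  imports "HOL-Probability.Probability" "HOL-Library.Landau_Symbols"
begin

definition joint_cdf :: "'a measure \<Rightarrow> ('a \<Rightarrow> real ^ 'd) \<Rightarrow> real ^ 'd \<Rightarrow> real" where
  "joint_cdf M Z x = \<P>(\<omega> in M. \<forall>i. Z \<omega> $ i \<le> x $ i)"

text \<open>The limit below exists for every joint distribution function (it is monotone and bounded
  in \<open>z\<close>), so the totalisation of \<^const>\<open>Lim\<close> plays no role there.\<close>

definition margin :: "(real ^ 'd \<Rightarrow> real) \<Rightarrow> 'd \<Rightarrow> real \<Rightarrow> real" where
  "margin F j y = Lim at_top (\<lambda>z. F (\<chi> i. if i = j then y else z))"

definition gen_inverse :: "(real \<Rightarrow> real) \<Rightarrow> real \<Rightarrow> real" where
  "gen_inverse H u = Inf {y. H y \<ge> u}"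

definition strictly_stationary :: "'a measure \<Rightarrow> (nat \<Rightarrow> 'a \<Rightarrow> 'b::topological_space) \<Rightarrow> bool" where
  "strictly_stationary M X \<longleftrightarrow>
     (\<forall>n. X n \<in> borel_measurable M) \<and>
     (\<forall>h. distr M (\<Pi>\<^sub>M n\<in>UNIV. borel) (\<lambda>\<omega> n. X (n + h) \<omega>) =
          distr M (\<Pi>\<^sub>M n\<in>UNIV. borel) (\<lambda>\<omega> n. X n \<omega>))"

definition lag_exceedance_prob ::
  "'a measure \<Rightarrow> (real ^ 'd \<Rightarrow> real) \<Rightarrow> (nat \<Rightarrow> 'a \<Rightarrow> real ^ 'd) \<Rightarrow> nat \<Rightarrow> 'd \<Rightarrow> 'd \<Rightarrow> real \<Rightarrow> real" where
  "lag_exceedance_prob M F X r j j' t =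
     \<P>(\<omega> in M. margin F j' (X (1 + r) \<omega> $ j') > 1 - t \<bar> margin F j (X 1 \<omega> $ j) > 1 - t)"

text \<open>Both coefficients are rendered as relations, "the coefficient exists and equals
  \<open>l\<close> (resp. \<open>\<eta>\<close>)". The parameter \<open>F\<close> is the common
  distribution function of the vectors \<open>X n\<close>.\<close>

definition has_tail_dependence_coeff ::
  "'a measure \<Rightarrow> (real ^ 'd \<Rightarrow> real) \<Rightarrow> (nat \<Rightarrow> 'a \<Rightarrow> real ^ 'd) \<Rightarrow> nat \<Rightarrow> 'd \<Rightarrow> 'd \<Rightarrow> real \<Rightarrow> bool" where
  "has_tail_dependence_coeff M F X r j j' l \<longleftrightarrow>
     (lag_exceedance_prob M F X r j j' \<longlongrightarrow> l) (at_right 0)"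

definition slowly_varying_at_0 :: "(real \<Rightarrow> real) \<Rightarrow> bool" where
  "slowly_varying_at_0 L \<longleftrightarrow> (\<forall>x>0. ((\<lambda>t. L (t * x) / L t) \<longlongrightarrow> 1) (at_right 0))"

definition has_ledford_tawn_coeff ::
  "'a measure \<Rightarrow> (real ^ 'd \<Rightarrow> real) \<Rightarrow> (nat \<Rightarrow> 'a \<Rightarrow> real ^ 'd) \<Rightarrow> nat \<Rightarrow> 'd \<Rightarrow> 'd \<Rightarrow> real \<Rightarrow> bool" where
  "has_ledford_tawn_coeff M F X r j j' \<eta> \<longleftrightarrow>
     0 < \<eta> \<and> \<eta> \<le> 1 \<and>
     (\<exists>L. slowly_varying_at_0 L \<and>
       lag_exceedance_prob M F X r j j' \<sim>[at_right 0] (\<lambda>t. L t * t powr (1 / \<eta> - 1)))"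

end

theory Submission
  imports Defs
begin

text \<open>
  Write \<open>H = margin F j'\<close>, \<open>c = c j'\<close>, \<open>w = gen_inverse H (1 - t)\<close> and
  \<open>s = 1 - H (c powr (- r) * w)\<close>, so that the hypothesis on the tail reads \<open>s \<sim> t powr a\<close> with
  \<open>a = c powr (- r * k) > 1\<close>; in particular \<open>s = o(t)\<close>. Unrolling the recursion over
  \<open>r\<close> steps, component \<open>j'\<close> of \<open>X (1 + r)\<close> is at most \<open>w\<close> iff component \<open>j'\<close> of \<open>X 1\<close> is at most
  \<open>c powr (- r) * w\<close> (event \<open>S\<close>, of probability \<open>1 - s\<close>) and the innovations at times
  \<open>2, \<dots>, 1 + r\<close> are small enough (event \<open>V\<close>). The event \<open>V\<close> is independent of \<open>X 1\<close>, and
  \<open>P(S \<inter> V) = 1 - t\<close> determines \<open>P(V) = (1 - t) / (1 - s)\<close>.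

  With \<open>A\<close> the exceedance event at time 1, of probability \<open>t\<close>, and \<open>q = P(A - S)\<close>, the
  lagged conditional exceedance probability is therefore exactly
  \<open>p(t) = (t - s + q / t * (1 - t)) / (1 - s)\<close>. Only \<open>0 \<le> q \<le> s\<close> is
  known about the cross-sectional dependence, but it suffices: for small \<open>t\<close>, \<open>p(t)\<close> lies between positive multiples of \<open>t\<close>
  and of \<open>t powr min 1 (a - 1)\<close> (\<open>lag_exceedance_prob_bounds\<close>, \<open>exceedance_prob_order\<close>).
  Hence \<open>p(t)\<close> tends to 0. If moreover \<open>p(t) \<sim> L(t) * t powr \<rho>\<close> with \<open>L\<close> slowly varying and
  \<open>\<rho> = 1 / \<eta> - 1\<close>, comparison of exponents (\<open>regularly_varying_index_le\<close> and
  \<open>regularly_varying_index_ge\<close>) gives \<open>min 1 (a - 1) \<le> \<rho> \<le> 1\<close>, that is,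
  \<open>1 / 2 \<le> \<eta> \<le> max (1 / 2) (1 / a)\<close>.
\<close>

section \<open>Marginal distribution functions\<close>

text \<open>Letting the other coordinates of the argument tend to infinity costs at most the probability
  that the norm of the vector exceeds them, and that probability vanishes.\<close>

lemma (in prob_space) margin_joint_cdf:
  fixes Z :: "'a \<Rightarrow> real ^ 'd"
  assumes Z[measurable]: "Z \<in> borel_measurable M"
  shows "margin (joint_cdf M Z) i y = cdf (distr M borel (\<lambda>\<omega>. Z \<omega> $ i)) y"
proof -
  have [measurable]: "(\<lambda>\<omega>. Z \<omega> $ l) \<in> borel_measurable M" for l
    by (rule measurable_compose[OF Z borel_measurable_nth])
  interpret N: real_distribution "distr M borel (\<lambda>\<omega>. norm (Z \<omega>))"
    by (rule real_distribution_distr) measurable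
  define p where "p = prob {\<omega> \<in> space M. Z \<omega> $ i \<le> y}"
  define q where "q z = joint_cdf M Z (\<chi> l. if l = i then y else z)" for z
  have cdf_norm: "cdf (distr M borel (\<lambda>\<omega>. norm (Z \<omega>))) z = prob {\<omega> \<in> space M. norm (Z \<omega>) \<le> z}" for z
    by (simp add: cdf_def measure_distr vimage_def Int_def conj_commute)
  have meas[measurable]: "{\<omega> \<in> space M. \<forall>l. Z \<omega> $ l \<le> (\<chi> l. if l = i then y else z) $ l} \<in> events" for z
    by measurable
  have upper: "q z \<le> p" for z
    unfolding p_def q_def joint_cdf_def
    by (rule finite_measure_mono) (auto dest: spec[of _ i])
  have lower: "p - (1 - prob {\<omega> \<in> space M. norm (Z \<omega>) \<le> z}) \<le> q z" for z
  proof -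
    have "p \<le> prob ({\<omega> \<in> space M. \<forall>l. Z \<omega> $ l \<le> (\<chi> l. if l = i then y else z) $ l}
                 \<union> (space M - {\<omega> \<in> space M. norm (Z \<omega>) \<le> z}))"
      unfolding p_def
    proof (rule finite_measure_mono)
      have "Z \<omega> $ l \<le> (\<chi> l. if l = i then y else z) $ l"
        if "Z \<omega> $ i \<le> y" "norm (Z \<omega>) \<le> z" for \<omega> l
        using that component_le_norm_cart[of "Z \<omega>" l] by auto
      then show "{\<omega> \<in> space M. Z \<omega> $ i \<le> y} \<subseteq>
          {\<omega> \<in> space M. \<forall>l. Z \<omega> $ l \<le> (\<chi> l. if l = i then y else z) $ l}
          \<union> (space M - {\<omega> \<in> space M. norm (Z \<omega>) \<le> z})"
        by blast
    qed measurable
    also have "\<dots> \<le> q z + prob (space M - {\<omega> \<in> space M. norm (Z \<omega>) \<le> z})"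
      unfolding q_def joint_cdf_def by (rule measure_Un_le) simp_all
    finally show ?thesis
      by (simp add: prob_compl)
  qed
  have "(q \<longlongrightarrow> p) at_top"
  proof (rule tendsto_sandwich[OF always_eventually always_eventually _ tendsto_const])
    have "((\<lambda>z. prob {\<omega> \<in> space M. norm (Z \<omega>) \<le> z}) \<longlongrightarrow> 1) at_top"
      using N.cdf_lim_at_top_prob unfolding cdf_norm[abs_def] .
    from tendsto_diff[OF tendsto_const[of p] tendsto_diff[OF tendsto_const[of 1] this]]
    show "((\<lambda>z. p - (1 - prob {\<omega> \<in> space M. norm (Z \<omega>) \<le> z})) \<longlongrightarrow> p) at_top"
      by simp
  qed (use upper lower in auto)
  hence "Lim at_top q = p"
    by (intro tendsto_Lim) auto
  moreover have "p = cdf (distr M borel (\<lambda>\<omega>. Z \<omega> $ i)) y"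
    by (simp add: p_def cdf_def measure_distr vimage_def Int_def conj_commute)
  ultimately show ?thesis
    by (simp add: margin_def q_def[abs_def])
qed

context real_distribution
begin

lemma cdf_attains:
  assumes cont: "continuous_on UNIV (cdf M)" and v: "0 < v" "v < 1"
  shows "\<exists>y. cdf M y = v"
proof -
  have "eventually (\<lambda>x. cdf M x < v) at_bot" "eventually (\<lambda>x. v < cdf M x) at_top"
    using order_tendstoD(2)[OF cdf_lim_at_bot v(1)] order_tendstoD(1)[OF cdf_lim_at_top_prob v(2)] .
  then obtain a b where "cdf M a < v" "v < cdf M b"
    by (metis eventually_at_bot_linorder eventually_at_top_linorder order_refl)
  moreover from this have "a \<le> b"
    using cdf_nondecreasing[of b a] by linarith
  ultimately show ?thesis
    using IVT'[of "cdf M" a v b] cont by (meson continuous_on_subset less_imp_le top_greatest)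
qed

text \<open>By continuity the infimum defining the generalized inverse is attained, so that the level
  \<open>v\<close> is hit exactly.\<close>

lemma cdf_gen_inverse:
  assumes cont: "continuous_on UNIV (cdf M)" and v: "0 < v" "v < 1"
  shows "cdf M (gen_inverse (cdf M) v) = v"
proof -
  let ?S = "{y. cdf M y \<ge> v}"
  from cdf_attains[OF assms] obtain y where y: "cdf M y = v" ..
  from cdf_attains[OF cont, of "v / 2"] v obtain a where "cdf M a = v / 2" by auto
  then have bdd: "bdd_below ?S"
    using v cdf_nondecreasing[of _ a] by (intro bdd_belowI[of _ a]) (smt (verit) field_sum_of_halves mem_Collect_eq)
  have "closed ?S"
    using cont by (intro closed_Collect_le) auto
  then have "Inf ?S \<in> ?S"
    using y bdd by (intro closed_contains_Inf) auto
  moreover have "Inf ?S \<le> y"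
    using y bdd by (intro cInf_lower) auto
  then have "cdf M (Inf ?S) \<le> v"
    using cdf_nondecreasing y by metis
  ultimately show ?thesis
    by (simp add: gen_inverse_def)
qed

text \<open>The probability integral transform: \<open>H(U)\<close> is uniform for \<open>U\<close> with continuous distribution
  function \<open>H\<close>. As \<open>H\<close> may be constant on intervals, the event \<open>H(U) \<le> v\<close> can be strictly larger than
  \<open>U \<le> y\<close> with \<open>H(y) = v\<close>; it is enclosed between such events at levels \<open>v\<close> and
  \<open>u > v\<close>.\<close>

lemma prob_cdf_le:
  assumes cont: "continuous_on UNIV (cdf M)" and v: "0 < v" "v < 1"
  shows "prob {x. cdf M x \<le> v} = v"
proof (rule antisym)
  have [measurable]: "cdf M \<in> borel_measurable borel"
    using cont by (rule borel_measurable_continuous_onI)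
  have sets: "{x. cdf M x \<le> v} \<in> events" by simp
  show "prob {x. cdf M x \<le> v} \<le> v"
  proof (rule dense_ge_bounded[OF v(2)])
    fix u assume u: "v < u" "u < 1"
    with v cdf_attains[OF cont, of u] obtain y where y: "cdf M y = u" by auto
    have "{x. cdf M x \<le> v} \<subseteq> {..y}"
      using u y cdf_nondecreasing[of y] by (auto simp: not_le[symmetric]) (metis leD less_imp_le linorder_not_le order_trans)
    then have "prob {x. cdf M x \<le> v} \<le> cdf M y"
      unfolding cdf_def by (rule finite_measure_mono) simp
    then show "prob {x. cdf M x \<le> v} \<le> u" using y by simp
  qed
  from cdf_attains[OF assms] obtain y where y: "cdf M y = v" ..
  have "prob {..y} \<le> prob {x. cdf M x \<le> v}"
    using y cdf_nondecreasing[of _ y] by (intro finite_measure_mono sets) auto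
  then show "v \<le> prob {x. cdf M x \<le> v}" using y by (simp add: cdf_def2)
qed

end

section \<open>Regular variation\<close>

text \<open>Otherwise the quotient \<open>u n / b ^ n\<close> would pass the ratio test and hence tend to 0, while it
  stays above \<open>C\<close>.\<close>

lemma geometric_le_ratio_limit:
  fixes u :: "nat \<Rightarrow> real"
  assumes ratio: "(\<lambda>n. u (Suc n) / u n) \<longlonglongrightarrow> l"
    and C: "C > 0" and b: "b > 0"
    and lower: "eventually (\<lambda>n. C * b ^ n \<le> u n) sequentially"
  shows "b \<le> l"
proof (rule ccontr)
  assume "\<not> b \<le> l"
  then have "l / b < 1" using b by simp
  then obtain m where m: "l / b < m" "m < 1" using dense by blast
  define v where "v n = u n / b ^ n" for n
  have "eventually (\<lambda>n. u (Suc n) / u n < m * b) sequentially"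
    using order_tendstoD(2)[OF ratio] m(1) b by (simp add: field_simps)
  from eventually_conj[OF lower this] obtain N where N: "\<And>n. n \<ge> N \<Longrightarrow> C * b ^ n \<le> u n \<and> u (Suc n) / u n < m * b"
    unfolding eventually_sequentially by blast
  have pos: "u n > 0" if "n \<ge> N" for n
    using N[OF that] C b by (meson less_le_trans mult_pos_pos zero_less_power)
  have "summable v"
  proof (rule summable_ratio_test[OF m(2), of N])
    fix n assume n: "n \<ge> N"
    show "norm (v (Suc n)) \<le> m * norm (v n)"
      using N[OF n] pos[OF n] pos[of "Suc n"] n b by (simp add: v_def field_simps)
  qed
  then have "v \<longlonglongrightarrow> 0" by (rule summable_LIMSEQ_zero)
  then have "eventually (\<lambda>n. v n < C) sequentially"
    using C by (rule order_tendstoD)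
  moreover have "eventually (\<lambda>n. C \<le> v n) sequentially"
    using lower by eventually_elim (use b in \<open>simp add: v_def field_simps\<close>)
  ultimately have "eventually (\<lambda>n::nat. False) sequentially"
    by eventually_elim simp
  then show False by simp
qed

lemma filterlim_half_power: "filterlim (\<lambda>n. (1 / 2 :: real) ^ n) (at_right 0) sequentially"
  by (intro tendsto_imp_filterlim_at_right LIMSEQ_power_zero always_eventually) auto

text \<open>Along the points \<open>2 powr (- n)\<close> slow variation is used for the single factor 1/2. The index of regular
  variation can then be read off from one geometric sequence, without uniform estimates for
  \<open>L\<close>.\<close>

lemma regularly_varying_dyadic_ratio:
  fixes p L :: "real \<Rightarrow> real"
  assumes L: "slowly_varying_at_0 L"
    and p: "p \<sim>[at_right 0] (\<lambda>t. L t * t powr \<rho>)"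
  shows "(\<lambda>n. p ((1 / 2) ^ Suc n) / p ((1 / 2) ^ n)) \<longlonglongrightarrow> (1 / 2) powr \<rho>"
proof -
  define g where "g t = L t * t powr \<rho>" for t :: real
  note seq = filterlim_half_power
  have "(\<lambda>n. p ((1 / 2) ^ Suc n) / p ((1 / 2) ^ n)) \<sim>[sequentially]
        (\<lambda>n. g ((1 / 2) ^ Suc n) / g ((1 / 2) ^ n))"
    using p unfolding g_def
    by (intro asymp_equiv_intros asymp_equiv_compose'[OF p] seq filterlim_compose[OF seq filterlim_Suc])
  moreover have "g ((1 / 2) ^ Suc n) / g ((1 / 2) ^ n) =
      L ((1 / 2) ^ n * (1 / 2)) / L ((1 / 2) ^ n) * (1 / 2) powr \<rho>" for n
    by (simp add: g_def powr_mult[symmetric] powr_mult mult.commute powr_divide)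
  moreover have "(\<lambda>n. L ((1 / 2) ^ n * (1 / 2)) / L ((1 / 2) ^ n)) \<longlonglongrightarrow> 1"
    by (rule filterlim_compose[OF _ seq]) (use L in \<open>simp add: slowly_varying_at_0_def del: times_divide_eq_right\<close>)
  then have "(\<lambda>n. L ((1 / 2) ^ n * (1 / 2)) / L ((1 / 2) ^ n) * (1 / 2) powr \<rho>) \<longlonglongrightarrow> 1 * (1 / 2) powr \<rho>"
    by (rule tendsto_mult_right)
  ultimately show ?thesis
    by (simp add: tendsto_asymp_equiv_cong)
qed

lemma half_powr_le_iff: "(1 / 2) powr a \<le> (1 / 2 :: real) powr b \<longleftrightarrow> b \<le> a"
  by (simp add: powr_divide field_simps)

text \<open>A lower bound by a power bounds the limit of the dyadic ratios from below.\<close>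

lemma regularly_varying_index_le:
  fixes p L :: "real \<Rightarrow> real"
  assumes "slowly_varying_at_0 L" "p \<sim>[at_right 0] (\<lambda>t. L t * t powr \<rho>)"
    and "C > 0" and lower: "eventually (\<lambda>t. C * t powr b \<le> p t) (at_right 0)"
  shows "\<rho> \<le> b"
proof -
  have "(1 / 2) powr b \<le> (1 / 2 :: real) powr \<rho>"
  proof (rule geometric_le_ratio_limit[OF regularly_varying_dyadic_ratio[OF assms(1,2)] \<open>C > 0\<close>])
    show "eventually (\<lambda>n. C * ((1 / 2) powr b) ^ n \<le> p ((1 / 2) ^ n)) sequentially"
      using eventually_compose_filterlim[OF lower filterlim_half_power]
      by eventually_elim (simp add: powr_power powr_realpow[symmetric] powr_powr mult.commute)
  qed simp
  then show ?thesis by (simp add: half_powr_le_iff)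
qed

text \<open>Taking reciprocals turns the upper bound into a lower bound, to which the same comparison applies;
  this is why positivity of \<open>p\<close> is assumed.\<close>

lemma regularly_varying_index_ge:
  fixes p L :: "real \<Rightarrow> real"
  assumes "slowly_varying_at_0 L" "p \<sim>[at_right 0] (\<lambda>t. L t * t powr \<rho>)"
    and "C > 0" and upper: "eventually (\<lambda>t. 0 < p t \<and> p t \<le> C * t powr b) (at_right 0)"
  shows "b \<le> \<rho>"
proof -
  have "inverse ((1 / 2) powr b) \<le> inverse ((1 / 2 :: real) powr \<rho>)"
  proof (rule geometric_le_ratio_limit)
    show "(\<lambda>n. inverse (p ((1 / 2) ^ Suc n)) / inverse (p ((1 / 2) ^ n))) \<longlonglongrightarrow> inverse ((1 / 2) powr \<rho>)"
      using tendsto_inverse[OF regularly_varying_dyadic_ratio[OF assms(1,2)]]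
      by (simp add: field_simps)
    show "inverse C > 0" using \<open>C > 0\<close> by simp
    have *: "inverse C * inverse ((1 / 2) powr b) ^ n \<le> inverse (p ((1 / 2) ^ n))"
      if "0 < p ((1 / 2) ^ n) \<and> p ((1 / 2) ^ n) \<le> C * ((1 / 2) ^ n) powr b" for n
    proof -
      have "inverse (C * ((1 / 2) ^ n) powr b) \<le> inverse (p ((1 / 2) ^ n))"
        using that by (intro le_imp_inverse_le) auto
      then show ?thesis
        by (simp add: powr_power powr_realpow[symmetric] powr_powr mult.commute power_inverse)
    qed
    show "eventually (\<lambda>n. inverse C * inverse ((1 / 2) powr b) ^ n \<le> inverse (p ((1 / 2) ^ n))) sequentially"
      using eventually_compose_filterlim[OF upper filterlim_half_power]
      by eventually_elim (rule *)
  qed simp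
  then show ?thesis by (simp add: half_powr_le_iff)
qed

section \<open>The lagged exceedance probability\<close>

text \<open>A maximum is below a level iff all its terms are, so each step of the recursion replaces the level
  \<open>w\<close> by \<open>w / c\<close> and contributes one condition on an innovation. Thresholds of either sign
  are treated alike because \<open>c\<close> is positive.\<close>

lemma max_recursion_le_iff:
  fixes x y :: "nat \<Rightarrow> real"
  assumes "c > 0" and rec: "\<And>n. x (Suc n) = max (c * x n) (y (Suc n))"
  shows "x (m + r) \<le> w \<longleftrightarrow> x m \<le> c powr (- real r) * w \<and> (\<forall>i<r. c ^ i * y (m + r - i) \<le> w)"
proof -
  have "x (m + r) \<le> w \<longleftrightarrow> c ^ r * x m \<le> w \<and> (\<forall>i<r. c ^ i * y (m + r - i) \<le> w)"
  proof (induction r arbitrary: w)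
    case (Suc r)
    have scale: "c ^ Suc n * z \<le> w \<longleftrightarrow> c ^ n * z \<le> w / c" for z and n :: nat
      using \<open>c > 0\<close> by (simp add: field_simps)
    have "x (m + Suc r) \<le> w \<longleftrightarrow> x (m + r) \<le> w / c \<and> y (m + Suc r) \<le> w"
      using \<open>c > 0\<close> by (simp add: rec field_simps)
    then show ?case
      unfolding Suc.IH scale All_less_Suc2 by auto
  qed simp
  moreover have "c ^ r * x m \<le> w \<longleftrightarrow> x m \<le> c powr (- real r) * w"
    using \<open>c > 0\<close> by (simp add: powr_minus powr_realpow field_simps)
  ultimately show ?thesis by simp
qed

text \<open>The computation at a fixed threshold: \<open>V\<close> is independent of \<open>S\<close> and of \<open>A \<inter> S\<close>, and
  dividing the two product formulas eliminates the unknown probability of \<open>V\<close>. What remains unknown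
  is \<open>q = P(A - S)\<close>; the bounds come from \<open>q \<ge> 0\<close> and \<open>q \<le> s\<close>.\<close>

lemma (in prob_space) exceedance_prob_bounds:
  assumes [measurable]: "A \<in> events" "S \<in> events" "V \<in> events"
    and indep_AS: "prob (A \<inter> S \<inter> V) = prob (A \<inter> S) * prob V"
    and indep_S: "prob (S \<inter> V) = prob S * prob V"
    and A: "prob A = t" and SV: "prob (S \<inter> V) = 1 - t"
    and S: "prob S = 1 - s" and s: "s < 1" and t: "0 < t" "t < 1"
  shows "t - s \<le> prob (A - S \<inter> V) / t" "prob (A - S \<inter> V) / t \<le> (t + s / t) / (1 - s)"
proof -
  define q where "q = prob (A - S)"
  have "s \<ge> 0" using S prob_le_1[of S] by linarith
  have V: "prob V = (1 - t) / (1 - s)"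
    using indep_S SV S s by (simp add: field_simps)
  have q: "0 \<le> q" "q \<le> s"
  proof -
    have "q \<le> prob (space M - S)"
      unfolding q_def using sets.sets_into_space[OF assms(1)] by (intro finite_measure_mono) auto
    then show "q \<le> s" using S by (simp add: prob_compl)
  qed (simp add: q_def)
  have AS: "prob (A \<inter> S) = t - q"
    using finite_measure_Diff'[of A S] A by (simp add: q_def)
  have "prob (A - S \<inter> V) = t - prob (A \<inter> S \<inter> V)"
    using finite_measure_Diff'[of A "S \<inter> V"] A by (simp add: Int_assoc)
  also have "\<dots> = (t * (t - s) + q * (1 - t)) / (1 - s)"
    using s unfolding indep_AS AS V by (simp add: field_simps)
  finally have AB: "prob (A - S \<inter> V) = (t * (t - s) + q * (1 - t)) / (1 - s)" .
  have frac: "(t * (t - s) + q * (1 - t)) / t = t - s + q / t * (1 - t)"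
    using t by (simp add: add_divide_distrib)
  have eq: "prob (A - S \<inter> V) / t = (t - s + q / t * (1 - t)) / (1 - s)"
    unfolding AB frac[symmetric] by (simp only: divide_divide_eq_left mult.commute)
  show "t - s \<le> prob (A - S \<inter> V) / t"
  proof (cases "s \<le> t")
    case True
    have "(t - s) * (1 - s) \<le> (t - s) * 1"
      using True \<open>s \<ge> 0\<close> by (intro mult_left_mono) auto
    also have "\<dots> \<le> t - s + q / t * (1 - t)"
      using q t by simp
    finally show ?thesis
      unfolding eq using s by (simp add: pos_le_divide_eq)
  next
    case False
    moreover have "0 \<le> prob (A - S \<inter> V) / t"
      using t by simp
    ultimately show ?thesis by linarith
  qed
  have "q / t * (1 - t) \<le> s / t * 1"
    using q t by (intro mult_mono divide_right_mono) auto
  then show "prob (A - S \<inter> V) / t \<le> (t + s / t) / (1 - s)"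
    unfolding eq using s \<open>s \<ge> 0\<close> by (intro divide_right_mono) auto
qed

text \<open>The vector \<open>X 1\<close> is a function of \<open>X 0\<close> and \<open>Y 1\<close>, whereas \<open>V\<close> involves only \<open>Y 2\<close>, ...,
  \<open>Y (1 + r)\<close>: two disjoint blocks of an independent family.\<close>

lemma (in prob_space) max_autoregression_indep:
  fixes X Y :: "nat \<Rightarrow> 'a \<Rightarrow> real ^ 'd" and c :: "'d \<Rightarrow> real" and a :: "nat \<Rightarrow> real" and r l w
  assumes indep: "indep_vars (\<lambda>_. borel) (\<lambda>n. if n = 0 then X 0 else Y n) UNIV"
    and rec: "\<And>n i \<omega>. n \<ge> 1 \<Longrightarrow> \<omega> \<in> space M \<Longrightarrow>
           X n \<omega> $ i = max (c i * X (n - 1) \<omega> $ i) (Y n \<omega> $ i)"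
    and S: "S \<in> sets borel"
  defines "V \<equiv> {\<omega> \<in> space M. \<forall>i<r. a i * Y (1 + r - i) \<omega> $ l \<le> w}"
  shows "prob ({\<omega> \<in> space M. X 1 \<omega> \<in> S} \<inter> V) = prob {\<omega> \<in> space M. X 1 \<omega> \<in> S} * prob V"
proof -
  define Z where "Z n = (if n = 0 then X 0 else Y n)" for n
  define f :: "(nat \<Rightarrow> real ^ 'd) \<Rightarrow> real ^ 'd" where
    "f z = (\<chi> i. max (c i * z 0 $ i) (z 1 $ i))" for z
  define g :: "(nat \<Rightarrow> real ^ 'd) \<Rightarrow> bool" where
    "g z \<longleftrightarrow> (\<forall>i<r. a i * z (1 + r - i) $ l \<le> w)" for z
  let ?N = "\<lambda>I. PiM I (\<lambda>_::nat. borel :: (real ^ 'd) measure)"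
  let ?Z = "\<lambda>I \<omega>. restrict (\<lambda>i. Z i \<omega>) I"
  have indep_var: "indep_var (?N {0,1}) (?Z {0,1}) (?N {2..}) (?Z {2..})"
    by (rule indep_var_restrict) (use indep in \<open>auto simp: Z_def[abs_def]\<close>)
  have component: "(\<lambda>z. z n $ i) \<in> borel_measurable (?N I)" if "n \<in> I" for n i I
    by (rule measurable_compose[OF measurable_component_singleton[OF that] borel_measurable_nth])
  have "f \<in> borel_measurable (?N {0,1})"
  proof -
    have "(\<lambda>z. max (c i * z 0 $ i) (z 1 $ i)) \<in> borel_measurable (?N {0,1})" for i
      by (intro borel_measurable_max borel_measurable_times borel_measurable_const component) auto
    then show ?thesis
      unfolding f_def[abs_def]
      by (subst borel_measurable_euclidean_space) (auto simp: Basis_vec_def inner_axis simp del: One_nat_def)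
  qed
  then have 1: "f -` S \<inter> space (?N {0,1}) \<in> sets (?N {0,1})"
    using S by (rule measurable_sets)
  have "{z \<in> space (?N {2..}). \<forall>i\<in>{..<r}. a i * z (1 + r - i) $ l \<le> w} \<in> sets (?N {2..})"
  proof (rule sets.sets_Collect_finite_All)
    fix i assume "i \<in> {..<r}"
    then have [measurable]: "(\<lambda>z. z (1 + r - i) $ l) \<in> borel_measurable (?N {2..})"
      by (intro component) auto
    show "{z \<in> space (?N {2..}). a i * z (1 + r - i) $ l \<le> w} \<in> sets (?N {2..})" by measurable
  qed simp
  then have 2: "{z \<in> space (?N {2..}). g z} \<in> sets (?N {2..})"
    unfolding g_def Ball_def lessThan_iff .
  have f: "f (?Z {0,1} \<omega>) = X 1 \<omega>" if "\<omega> \<in> space M" for \<omega>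
    using rec[OF _ that, of 1] by (simp add: f_def Z_def vec_eq_iff)
  have g: "g (?Z {2..} \<omega>) \<longleftrightarrow> \<omega> \<in> V" if "\<omega> \<in> space M" for \<omega>
    using that by (auto simp: g_def Z_def V_def)
  have "?Z {0,1} -` (f -` S \<inter> space (?N {0,1})) \<inter> space M = {\<omega> \<in> space M. X 1 \<omega> \<in> S}"
    using f by (auto simp: space_PiM)
  moreover have "?Z {2..} -` {z \<in> space (?N {2..}). g z} \<inter> space M = V"
    using g by (auto simp: space_PiM V_def)
  moreover have "(\<lambda>\<omega>. (?Z {0,1} \<omega>, ?Z {2..} \<omega>)) -`
      ((f -` S \<inter> space (?N {0,1})) \<times> {z \<in> space (?N {2..}). g z}) \<inter> space M
    = {\<omega> \<in> space M. X 1 \<omega> \<in> S} \<inter> V"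
    unfolding calculation[symmetric] by blast
  ultimately show ?thesis
    using indep_varD[OF indep_var 1 2] by (simp only:)
qed

text \<open>Unrolling the recursion turns the events of the model into the \<open>A\<close>, \<open>S\<close> and \<open>V\<close> of
  \<open>exceedance_prob_bounds\<close>, and continuity of the margins gives \<open>A\<close> and the exceedance at time \<open>1 + r\<close>
  probability exactly \<open>t\<close>.\<close>

lemma (in prob_space) lag_exceedance_prob_bounds:
  fixes X Y :: "nat \<Rightarrow> 'a \<Rightarrow> real ^ 'd" and F :: "real ^ 'd \<Rightarrow> real" and c :: "'d \<Rightarrow> real" and j j' r t
  assumes c: "\<And>i. 0 < c i"
    and indep: "indep_vars (\<lambda>_. borel) (\<lambda>n. if n = 0 then X 0 else Y n) UNIV"
    and rec: "\<And>n i \<omega>. n \<ge> 1 \<Longrightarrow> \<omega> \<in> space M \<Longrightarrow>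
           X n \<omega> $ i = max (c i * X (n - 1) \<omega> $ i) (Y n \<omega> $ i)"
    and X: "\<And>n. X n \<in> borel_measurable M"
    and F: "\<And>n. joint_cdf M (X n) = F"
    and cont: "\<And>i. continuous_on UNIV (margin F i)"
    and t: "0 < t" "t < 1"
  defines "s \<equiv> 1 - margin F j' (c j' powr (- real r) * gen_inverse (margin F j') (1 - t))"
  assumes s: "s < 1"
  shows "t - s \<le> lag_exceedance_prob M F X r j j' t"
    and "lag_exceedance_prob M F X r j j' t \<le> (t + s / t) / (1 - s)"
proof -
  note [measurable] = X
  have Y: "Y n \<in> borel_measurable M" if "n \<noteq> 0" for n
    using indep that unfolding indep_vars_def by (auto dest: spec[of _ n])
  have [measurable]: "(\<lambda>\<omega>. X n \<omega> $ i) \<in> borel_measurable M" for n i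
    by (rule measurable_compose[OF X borel_measurable_nth])
  have distribution: "real_distribution (distr M borel (\<lambda>\<omega>. X n \<omega> $ i))" for n i
    by (rule real_distribution_distr) measurable
  have margin: "margin F i = cdf (distr M borel (\<lambda>\<omega>. X n \<omega> $ i))" for n i
    using margin_joint_cdf[OF X, of n i] by (auto simp: F)
  have prob_le: "prob {\<omega> \<in> space M. X n \<omega> $ i \<le> x} = margin F i x" for n i x
    by (simp add: margin[of i n] cdf_def measure_distr vimage_def Int_def conj_commute)
  have [measurable]: "margin F i \<in> borel_measurable borel" for i
    using cont by (rule borel_measurable_continuous_onI)
  have mono: "margin F i x \<le> margin F i y" if "x \<le> y" for i x y
    using that real_distribution.finite_borel_measure_M[OF distribution[of 0 i]] unfolding margin[of i 0]
    by (rule finite_borel_measure.cdf_nondecreasing[rotated])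
  have prob_margin: "prob {\<omega> \<in> space M. margin F i (X n \<omega> $ i) \<le> 1 - t} = 1 - t" for n i
  proof -
    have "measure (distr M borel (\<lambda>\<omega>. X n \<omega> $ i)) {x. margin F i x \<le> 1 - t} = 1 - t"
      using real_distribution.prob_cdf_le[OF distribution[of n i]] cont[of i] t
      unfolding margin[of i n] by simp
    then show ?thesis
      by (subst (asm) measure_distr) (simp_all add: vimage_def Int_def conj_commute)
  qed
  define w where "w = gen_inverse (margin F j') (1 - t)"
  have w: "margin F j' w = 1 - t"
    using real_distribution.cdf_gen_inverse[OF distribution[of 0 j']] cont[of j'] t
    unfolding w_def margin[of j' 0] by simp
  define A where "A = {\<omega> \<in> space M. margin F j (X 1 \<omega> $ j) > 1 - t}"
  define S where "S = {\<omega> \<in> space M. X 1 \<omega> $ j' \<le> c j' powr (- real r) * w}"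
  define V where "V = {\<omega> \<in> space M. \<forall>i<r. c j' ^ i * Y (1 + r - i) \<omega> $ j' \<le> w}"
  define B where "B = {\<omega> \<in> space M. margin F j' (X (1 + r) \<omega> $ j') \<le> 1 - t}"
  have A[measurable]: "A \<in> events" and S[measurable]: "S \<in> events" and B[measurable]: "B \<in> events"
    unfolding A_def S_def B_def by measurable
  have V[measurable]: "V \<in> events"
  proof -
    have "{\<omega> \<in> space M. \<forall>i\<in>{..<r}. c j' ^ i * Y (1 + r - i) \<omega> $ j' \<le> w} \<in> events"
    proof (rule sets.sets_Collect_finite_All)
      fix i assume "i \<in> {..<r}"
      then have [measurable]: "(\<lambda>\<omega>. Y (1 + r - i) \<omega> $ j') \<in> borel_measurable M"
        by (intro measurable_compose[OF Y borel_measurable_nth]) simp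
      show "{\<omega> \<in> space M. c j' ^ i * Y (1 + r - i) \<omega> $ j' \<le> w} \<in> events" by measurable
    qed simp
    then show ?thesis unfolding V_def Ball_def lessThan_iff .
  qed
  have SV: "S \<inter> V = {\<omega> \<in> space M. X (1 + r) \<omega> $ j' \<le> w}"
  proof -
    have "X (1 + r) \<omega> $ j' \<le> w \<longleftrightarrow> X 1 \<omega> $ j' \<le> c j' powr (- real r) * w \<and>
        (\<forall>i<r. c j' ^ i * Y (1 + r - i) \<omega> $ j' \<le> w)" if "\<omega> \<in> space M" for \<omega>
    proof (rule max_recursion_le_iff[OF c])
      show "X (Suc n) \<omega> $ j' = max (c j' * X n \<omega> $ j') (Y (Suc n) \<omega> $ j')" for n
        using rec[OF _ that, of "Suc n" j'] by simp
    qed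
    then show ?thesis by (auto simp: S_def V_def)
  qed
  \<comment> \<open>The exceedance is defined through \<open>H(X) > 1 - t\<close>, the recursion speaks of \<open>X > w\<close>. The two events
    can differ where \<open>H\<close> is flat, but one contains the other and both have probability \<open>t\<close>.\<close>
  have "AE \<omega> in M. \<omega> \<in> B \<longleftrightarrow> \<omega> \<in> S \<inter> V"
  proof -
    have sub: "S \<inter> V \<subseteq> B"
      using mono[of _ w j'] w by (auto simp: SV B_def)
    have "prob (B - S \<inter> V) = 0"
    proof -
      have "prob B = 1 - t" unfolding B_def by (rule prob_margin)
      moreover have "prob (S \<inter> V) = 1 - t" unfolding SV prob_le w ..
      ultimately show ?thesis using sub by (simp add: finite_measure_Diff)
    qed
    then have "AE \<omega> in M. \<omega> \<notin> B - S \<inter> V"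
      by (intro prob_eq_0[THEN iffD1]) auto
    with sub show ?thesis by (auto elim!: eventually_mono)
  qed
  then have "prob (A - B) = prob (A - S \<inter> V)"
    by (intro finite_measure_eq_AE) auto
  moreover have "A - B = {\<omega> \<in> space M. margin F j' (X (1 + r) \<omega> $ j') > 1 - t \<and> margin F j (X 1 \<omega> $ j) > 1 - t}"
    by (auto simp: A_def B_def)
  moreover have prob_A: "prob A = t"
  proof -
    have "A = space M - {\<omega> \<in> space M. margin F j (X 1 \<omega> $ j) \<le> 1 - t}"
      by (auto simp: A_def)
    then show ?thesis
      by (simp add: prob_compl prob_margin del: One_nat_def)
  qed
  ultimately have lag: "lag_exceedance_prob M F X r j j' t = prob (A - S \<inter> V) / t"
    by (simp add: lag_exceedance_prob_def cond_prob_def A_def)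
  have indep_V: "prob ({\<omega> \<in> space M. X 1 \<omega> \<in> T} \<inter> V) = prob {\<omega> \<in> space M. X 1 \<omega> \<in> T} * prob V"
    if "T \<in> sets borel" for T
    unfolding V_def by (rule max_autoregression_indep[OF indep rec that])
  have "prob (A \<inter> S \<inter> V) = prob (A \<inter> S) * prob V"
  proof -
    let ?T = "{x \<in> space borel. margin F j (x $ j) > 1 - t \<and> x $ j' \<le> c j' powr (- real r) * w}"
    have "A \<inter> S = {\<omega> \<in> space M. X 1 \<omega> \<in> ?T}"
      by (auto simp: A_def S_def)
    moreover have "?T \<in> sets borel"
      by measurable
    ultimately show ?thesis
      using indep_V[of ?T] by (simp only:)
  qed
  moreover have "prob (S \<inter> V) = prob S * prob V"
  proof -
    let ?T = "{x \<in> space borel. x $ j' \<le> c j' powr (- real r) * w}"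
    have "S = {\<omega> \<in> space M. X 1 \<omega> \<in> ?T}"
      by (auto simp: S_def)
    moreover have "?T \<in> sets borel"
      by measurable
    ultimately show ?thesis
      using indep_V[of ?T] by (simp only:)
  qed
  moreover have "prob (S \<inter> V) = 1 - t"
    unfolding SV prob_le w ..
  moreover have "prob S = 1 - s"
    unfolding S_def prob_le s_def w_def by simp
  ultimately show "t - s \<le> lag_exceedance_prob M F X r j j' t"
    "lag_exceedance_prob M F X r j j' t \<le> (t + s / t) / (1 - s)"
    unfolding lag using exceedance_prob_bounds[OF A S V _ _ prob_A _ _ s t] by auto
qed

section \<open>Order of the exceedance probability\<close>

lemma powr_at_right_0:
  assumes "b > 0"
  shows "((\<lambda>t::real. t powr b) \<longlongrightarrow> 0) (at_right 0)"
proof (rule tendsto_zero_powrI[OF tendsto_ident_at tendsto_const _ assms])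
  show "eventually (\<lambda>t::real. 0 \<le> t) (at_right 0)"
    by (rule eventually_mono[OF eventually_at_right_less]) simp
qed

text \<open>The lower constant 1/2 comes from \<open>s \<le> t / 2\<close>. The upper constant 6 comes from
  \<open>s / t \<le> 2 * t powr (a - 1)\<close>, which makes the numerator at most three times the larger of the two powers,
  and from a denominator of at least 1/2.\<close>

lemma exceedance_prob_order:
  fixes p s :: "real \<Rightarrow> real"
  assumes a: "a > 1" and s: "s \<sim>[at_right 0] (\<lambda>t. t powr a)"
    and lower: "\<And>t. 0 < t \<Longrightarrow> t < 1 \<Longrightarrow> s t < 1 \<Longrightarrow> t - s t \<le> p t"
    and upper: "\<And>t. 0 < t \<Longrightarrow> t < 1 \<Longrightarrow> s t < 1 \<Longrightarrow> p t \<le> (t + s t / t) / (1 - s t)"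
  shows "eventually (\<lambda>t. 1 / 2 * t powr 1 \<le> p t) (at_right 0)"
    and "eventually (\<lambda>t. 0 < p t \<and> p t \<le> 6 * t powr min 1 (a - 1)) (at_right 0)"
proof -
  have small: "eventually (\<lambda>t::real. 0 < t \<and> t < 1) (at_right 0)"
    unfolding eventually_at_right[OF zero_less_one] by (auto intro!: exI[of _ 1])
  have "((\<lambda>t. s t / t powr a) \<longlongrightarrow> 1) (at_right 0)"
    using asymp_equivD_strong[OF s] small by (simp add: eventually_mono)
  from order_tendstoD(2)[OF this, of 2]
  have s_le: "eventually (\<lambda>t. s t / t powr a < 2) (at_right 0)" by simp
  have "((\<lambda>t. t powr (a - 1)) \<longlongrightarrow> 0) (at_right (0::real))"
    using a by (intro powr_at_right_0) auto
  from order_tendstoD(2)[OF this, of "1 / 4"]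
  have "eventually (\<lambda>t::real. t powr (a - 1) < 1 / 4) (at_right 0)" by simp
  with small s_le have key: "eventually (\<lambda>t. 0 < t \<and> t < 1 \<and> s t \<le> 2 * t powr (a - 1) * t \<and> s t \<le> t / 2) (at_right 0)"
  proof eventually_elim
    case (elim t)
    have "s t \<le> 2 * t powr a" using elim by (simp add: divide_simps)
    also have "\<dots> = 2 * t powr (a - 1) * t" using elim by (simp add: powr_diff)
    finally have s1: "s t \<le> 2 * t powr (a - 1) * t" .
    also have "\<dots> \<le> 2 * (1 / 4) * t" using elim by (intro mult_mono) auto
    finally show ?case using s1 elim by simp
  qed
  then show "eventually (\<lambda>t. 1 / 2 * t powr 1 \<le> p t) (at_right 0)"
    by eventually_elim (use lower in force)
  from key show "eventually (\<lambda>t. 0 < p t \<and> p t \<le> 6 * t powr min 1 (a - 1)) (at_right 0)"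
  proof eventually_elim
    case (elim t)
    let ?m = "t powr min 1 (a - 1)"
    have t: "t \<le> ?m"
      using elim powr_mono'[of "min 1 (a - 1)" 1 t] by simp
    have "t powr (a - 1) \<le> ?m"
      using elim by (intro powr_mono') auto
    with elim have st: "s t / t \<le> 2 * ?m"
      by (simp add: divide_simps) (smt (verit) mult_right_mono)
    have "(t + s t / t) / (1 - s t) \<le> (3 * ?m) / (1 / 2)"
      using elim t st by (intro frac_le) auto
    with upper[of t] lower[of t] elim show ?case by auto
  qed
qed

theorem proposition5p4:
  fixes M :: "'a measure"
    and X Y :: "nat \<Rightarrow> 'a \<Rightarrow> real ^ 'd"
    and F G :: "real ^ 'd \<Rightarrow> real"
    and c :: "'d \<Rightarrow> real"
    and j j' :: 'd and r :: nat and k :: real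
  assumes "prob_space M"
    and "\<And>i. 0 < c i \<and> c i < 1"
    and "prob_space.indep_vars M (\<lambda>_. borel) (\<lambda>n. if n = 0 then X 0 else Y n) UNIV"
    and "\<And>n. n \<ge> 1 \<Longrightarrow> joint_cdf M (Y n) = G"
    and "\<And>n i \<omega>. n \<ge> 1 \<Longrightarrow> \<omega> \<in> space M \<Longrightarrow>
           X n \<omega> $ i = max (c i * X (n - 1) \<omega> $ i) (Y n \<omega> $ i)"
    and "strictly_stationary M X"
    and "\<And>n. joint_cdf M (X n) = F"
    and "\<And>i. continuous_on UNIV (margin F i)"
    and "r \<ge> 1"
    and "k > 0"
    and "(\<lambda>t. 1 - margin F j' (c j' powr (- real r) * gen_inverse (margin F j') (1 - t)))
           \<sim>[at_right 0] (\<lambda>t. t powr (c j' powr (- (real r * k))))"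
  shows "has_tail_dependence_coeff M F X r j j' 0 \<and>
         (\<forall>\<eta>. has_ledford_tawn_coeff M F X r j j' \<eta> \<longrightarrow>
              1 / 2 \<le> \<eta> \<and> \<eta> \<le> max (1 / 2) (c j' powr (real r * k)))"
proof -
  interpret prob_space M by fact
  let ?p = "lag_exceedance_prob M F X r j j'"
  define s where
    "s t = 1 - margin F j' (c j' powr (- real r) * gen_inverse (margin F j') (1 - t))" for t
  define a where "a = c j' powr (- (real r * k))"
  have c: "0 < c j'" "c j' < 1" using assms(2) by auto
  have a: "a > 1"
    using c \<open>r \<ge> 1\<close> \<open>k > 0\<close> powr_less_mono'[of "c j'" "- (real r * k)" 0] by (simp add: a_def)
  have inverse_a: "1 / a = c j' powr (real r * k)"
    by (simp add: a_def powr_minus divide_inverse)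
  have X: "X n \<in> borel_measurable M" for n
    using assms(6) by (simp add: strictly_stationary_def)
  note bounds = lag_exceedance_prob_bounds[of c X Y F _ j' r j, folded s_def,
      OF conjunct1[OF assms(2)] assms(3,5) X assms(7,8)]
  have asymp: "s \<sim>[at_right 0] (\<lambda>t. t powr a)"
    using assms(11) by (simp add: s_def[abs_def] a_def)
  note lower = exceedance_prob_order(1)[OF a asymp bounds]
  note upper = exceedance_prob_order(2)[OF a asymp bounds]
  have "(?p \<longlongrightarrow> 0) (at_right 0)"
  proof (rule tendsto_sandwich)
    show "eventually (\<lambda>t. 0 \<le> ?p t) (at_right 0)" "eventually (\<lambda>t. ?p t \<le> 6 * t powr min 1 (a - 1)) (at_right 0)"
      using upper by (auto elim: eventually_mono)
    show "((\<lambda>t::real. 6 * t powr min 1 (a - 1)) \<longlongrightarrow> 0) (at_right 0)"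
      using tendsto_mult_right_zero[OF powr_at_right_0, of "min 1 (a - 1)" 6] a by simp
  qed simp
  moreover have "1 / 2 \<le> \<eta> \<and> \<eta> \<le> max (1 / 2) (c j' powr (real r * k))"
    if "has_ledford_tawn_coeff M F X r j j' \<eta>" for \<eta>
  proof -
    from that obtain L where \<eta>: "0 < \<eta>" and L: "slowly_varying_at_0 L"
      "?p \<sim>[at_right 0] (\<lambda>t. L t * t powr (1 / \<eta> - 1))"
      unfolding has_ledford_tawn_coeff_def by blast
    have "1 / \<eta> - 1 \<le> 1"
      by (rule regularly_varying_index_le[OF L _ lower]) auto
    then have "1 / 2 \<le> \<eta>"
      using \<eta> by (simp add: field_simps)
    have "min 1 (a - 1) \<le> 1 / \<eta> - 1"
      by (rule regularly_varying_index_ge[OF L _ upper]) auto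
    then have "2 \<le> 1 / \<eta> \<or> a \<le> 1 / \<eta>" by linarith
    then have "\<eta> \<le> 1 / 2 \<or> \<eta> \<le> 1 / a"
      using \<eta> a by (simp add: field_simps)
    then show ?thesis
      using \<open>1 / 2 \<le> \<eta>\<close> by (auto simp: inverse_a)
  qed
  ultimately show ?thesis
    by (simp add: has_tail_dependence_coeff_def)
qed

end
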